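(* Let $\mathbb{F}_q$ be a finite field, let $f\in\mathbb{F}_q[x]$ be a nonzero monic polynomial, and let $D=\{f_1,\ldots,f_k\}$ be a nonempty set of monic divisors of $f$ with $f\notin D$ such that the gcd-graph $G_f(D)$ is both connected and anti-connected. Let $g$ be a monic divisor of $f$ and let $I$ be the ideal of $\mathbb{F}_q[x]/(f)$ generated by $g$. Put \[ D_1=\{f_i\in D : g\nmid f_i\},\qquad D_2=\{f_i\in D : g\mid f_i\}, \] \[ \overline{D_1}=\{\gcd(f_i,g) : f_i\in D_1\},\qquad \widetilde{D_2}=\left\{\tfrac{f_i}{g} : f_i\in D_2\right\}. \] Then the following statements are equivalent: (1) $I$ is a homogeneous set in $G_f(D)$; (2) $\{h\in\mathrm{Div}(f) : \gcd(h,g)\in\overline{D_1}\}=D_1$. Furthermore, if these equivalent conditions hold, then $G_f(D)$ is isomorphic to the wreath product $G_g(\overline{D_1}) * G_{f/g}(\widetilde{D_2})$.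
   Context: All polynomials are monic unless stated otherwise and gcd's are taken monic (so $\gcd(0,f)=f$). $\mathrm{Div}(f)$ is the set of monic divisors of $f$. For a nonzero monic $f\in\mathbb{F}_q[x]$ and a (possibly empty) set $D$ of monic divisors of $f$ with $f\notin D$, the gcd-graph $G_f(D)$ is the undirected loopless graph with vertex set the ring $\mathbb{F}_q[x]/(f)$ in which two vertices $u,v$ are adjacent if and only if $\gcd(u-v,f)\in D$. A graph is anti-connected if its complement is connected. A homogeneous set in a graph $G$ is a set $X\subseteq V(G)$ such that every vertex in $V(G)\setminus X$ is adjacent to either all or none of the vertices of $X$. The wreath product $G*H$ of graphs $G,H$ has vertex set $V(G)\times V(H)$, with $(g,h)$ and $(g',h')$ adjacent if either $(g,g')\in E(G)$, or $g=g'$ and $(h,h')\in E(H)$. *)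

theory Defs
  imports
    "HOL-Computational_Algebra.Polynomial_Factorial"
    "HOL-Algebra.Algebraic_Closure_Type"
    "Graph_Theory.Graph_Theory"
begin

text \<open>
  The coefficient field is a type of sort \<open>{finite, field_gcd}\<close>. The class \<open>field_gcd\<close> is the one
  under which the library equips polynomials over a field with \<open>gcd\<close>; it adds no condition on the
  field, and on polynomials \<open>gcd\<close> is zero or monic, with \<open>gcd 0 f = f\<close> for monic \<open>f\<close>.
\<close>

definition monic_divisors :: "'a :: field_gcd poly \<Rightarrow> 'a poly set" where
  "monic_divisors f = {h. lead_coeff h = 1 \<and> h dvd f}"

text \<open>
  The elements of the quotient ring are the cosets of the principal ideal of \<open>f\<close>, so they are sets
  of polynomials; \<open>ring_of_type_algebra\<close> is the type \<open>'a poly\<close> regarded as a ring with carrier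
  \<open>UNIV\<close>.
\<close>

definition poly_ideal :: "'a :: field_gcd poly \<Rightarrow> 'a poly set" where
  "poly_ideal f = PIdl\<^bsub>ring_of_type_algebra\<^esub> f"

definition poly_quot :: "'a :: field_gcd poly \<Rightarrow> 'a poly set ring" where
  "poly_quot f = ring_of_type_algebra Quot poly_ideal f"

definition residue_class :: "'a :: field_gcd poly \<Rightarrow> 'a poly \<Rightarrow> 'a poly set" where
  "residue_class f u = poly_ideal f +>\<^bsub>ring_of_type_algebra\<^esub> u"

text \<open>
  Undirected simple graphs are represented as digraphs without parallel arcs, each edge \<open>{u, v}\<close>
  being the two arcs \<open>(u, v)\<close> and \<open>(v, u)\<close>.

  In \<open>gcd_graph\<close>, \<open>gcd (u - v) f\<close> depends only on the residue classes of \<open>u\<close> and \<open>v\<close> and is symmetric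
  in them; there are no loops when \<open>f\<close> is monic and \<open>f \<notin> D\<close>, because \<open>gcd 0 f = f\<close>.
\<close>

definition gcd_graph :: "'a :: field_gcd poly \<Rightarrow> 'a poly set \<Rightarrow> 'a poly set pair_pre_digraph" where
  "gcd_graph f D =
     \<lparr> pverts = carrier (poly_quot f),
       parcs = {(residue_class f u, residue_class f v) | u v. gcd (u - v) f \<in> D} \<rparr>"

definition graph_complement :: "'v pair_pre_digraph \<Rightarrow> 'v pair_pre_digraph" where
  "graph_complement G =
     \<lparr> pverts = pverts G,
       parcs = {(u, v). u \<in> pverts G \<and> v \<in> pverts G \<and> u \<noteq> v \<and> (u, v) \<notin> parcs G} \<rparr>"

definition connected_graph :: "'v pair_pre_digraph \<Rightarrow> bool" where
  "connected_graph G \<longleftrightarrow> Digraph_Component.connected (with_proj G)"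

definition anti_connected :: "'v pair_pre_digraph \<Rightarrow> bool" where
  "anti_connected G \<longleftrightarrow> connected_graph (graph_complement G)"

definition homogeneous_set :: "'v pair_pre_digraph \<Rightarrow> 'v set \<Rightarrow> bool" where
  "homogeneous_set G S \<longleftrightarrow>
     S \<subseteq> pverts G \<and>
     (\<forall>v \<in> pverts G - S. (\<forall>x \<in> S. (v, x) \<in> parcs G) \<or> (\<forall>x \<in> S. (v, x) \<notin> parcs G))"

definition wreath_product ::
  "'v pair_pre_digraph \<Rightarrow> 'w pair_pre_digraph \<Rightarrow> ('v \<times> 'w) pair_pre_digraph" where
  "wreath_product G H =
     \<lparr> pverts = pverts G \<times> pverts H,
       parcs = {((g, h), (g', h')).
         (g, h) \<in> pverts G \<times> pverts H \<and> (g', h') \<in> pverts G \<times> pverts H \<and>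
         ((g, g') \<in> parcs G \<or> g = g' \<and> (h, h') \<in> parcs H)} \<rparr>"

definition isomorphic_graphs :: "'v pair_pre_digraph \<Rightarrow> 'w pair_pre_digraph \<Rightarrow> bool" where
  "isomorphic_graphs G H \<longleftrightarrow> digraph_iso (with_proj G) (with_proj H)"

end

theory Submission
  imports Defs
begin

text \<open>
  Everything rests on one observation: for \<open>g dvd f\<close>, the value
  \<open>gcd (gcd a f) g = gcd a g\<close> depends only on \<open>a\<close> modulo \<open>g\<close>. A vertex \<open>v\<close> outside \<open>I\<close>
  sees the members \<open>x\<close> of \<open>I\<close>, which are multiples of \<open>g\<close>, through the divisors
  \<open>gcd (v - x) f\<close>. These all have the same gcd with \<open>g\<close>, namely \<open>gcd v g\<close>, and none of them
  is divisible by \<open>g\<close>. If \<open>D1\<close> is closed, in that it contains every monic divisor of \<open>f\<close> that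
  has the same gcd with \<open>g\<close> as one of its members, then either all or none of these divisors
  lie in \<open>D\<close>, so \<open>I\<close> is homogeneous.

  For the converse, every divisor with the right gcd with \<open>g\<close> has to be realised as such a
  value. Let \<open>k \<in> D1\<close> and let \<open>h\<close> be a monic divisor of \<open>f\<close> with \<open>gcd h g = gcd k g\<close>. By
  \<open>coprime_multiplier_exists\<close> there is \<open>c\<close> coprime to \<open>f\<close> with \<open>h * c\<close> congruent to \<open>k\<close>
  modulo \<open>g\<close>. The vertex \<open>k\<close> is adjacent to \<open>0 \<in> I\<close>, as \<open>gcd k f = k \<in> D\<close>; by homogeneity
  it is adjacent to \<open>k - h * c \<in> I\<close>, which says \<open>h = gcd (h * c) f \<in> D\<close>.

  The isomorphism with the wreath product is division with remainder by \<open>g\<close>: the class of \<open>u\<close>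
  modulo \<open>f\<close> goes to the class of \<open>u\<close> modulo \<open>g\<close> paired with the class of the quotient
  \<open>u div g\<close> modulo \<open>f div g\<close>. For \<open>u\<close> and \<open>v\<close> in different classes modulo \<open>g\<close>, the closure
  of \<open>D1\<close> makes adjacency depend on \<open>gcd (u - v) g\<close> alone. Inside one class, \<open>gcd (u - v) f\<close>
  is \<open>g\<close> times the gcd of \<open>u div g - v div g\<close> with \<open>f div g\<close>.
\<close>

section \<open>Changing the representative of a unit residue\<close>

text \<open>
  For \<open>n dvd f\<close> this lifts units modulo \<open>n\<close> to units modulo \<open>f\<close>. Take for \<open>w\<close> the product of
  the primes that divide \<open>f\<close> but not \<open>a\<close>: a prime factor of \<open>f\<close> then divides exactly one of
  \<open>a\<close> and \<open>n * w\<close>, hence not their sum.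
\<close>

lemma coprime_add_mult_exists:
  fixes a n f :: "'a :: factorial_ring_gcd"
  assumes "coprime a n" and "f \<noteq> 0"
  shows "\<exists>w. coprime (a + n * w) f"
proof -
  define w where "w = \<Prod>{p \<in> prime_factors f. \<not> p dvd a}"
  have "is_unit c" if c: "c dvd a + n * w" "c dvd f" for c
  proof (rule ccontr)
    assume "\<not> is_unit c"
    moreover have "c \<noteq> 0" using c \<open>f \<noteq> 0\<close> by auto
    ultimately obtain p where p: "p dvd c" "Factorial_Ring.prime p"
      using prime_divisor_exists by blast
    have pf: "p dvd a + n * w" "p dvd f" using p c by (auto intro: dvd_trans)
    have pin: "p \<in> prime_factors f"
      using p pf \<open>f \<noteq> 0\<close> by (auto simp: prime_factors_dvd)
    show False
    proof (cases "p dvd a")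
      case True
      with pf have "p dvd n * w" by (simp add: dvd_add_right_iff)
      moreover have "\<not> p dvd n"
        using True p \<open>coprime a n\<close> by (meson coprime_common_divisor not_prime_unit)
      ultimately have "p dvd w" using p by (simp add: prime_dvd_mult_iff)
      then obtain r where r: "r \<in> prime_factors f" "\<not> r dvd a" "p dvd r"
        unfolding w_def using p by (auto simp: prime_dvd_prod_iff)
      then have "p = r" using p by (auto intro: primes_dvd_imp_eq in_prime_factors_imp_prime)
      with r True show False by simp
    next
      case False
      with pin have "p dvd w" unfolding w_def by (auto intro: dvd_prodI)
      with pf False show False by (simp add: dvd_add_left_iff)
    qed
  qed
  then have "coprime (a + n * w) f" by (auto intro: coprimeI)
  then show ?thesis ..
qed

text \<open>
  After division by the common gcd \<open>d\<close> with \<open>g\<close>, both \<open>h div d\<close> and \<open>k div d\<close> are units modulo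
  \<open>g div d\<close>, so their quotient is a unit there, and its class has a member coprime to \<open>f\<close>.
\<close>

lemma coprime_multiplier_exists:
  fixes f g h k :: "'a :: euclidean_ring_gcd"
  assumes "gcd h g = gcd k g" and "g \<noteq> 0" and "f \<noteq> 0"
  shows "\<exists>c. coprime c f \<and> g dvd h * c - k"
proof -
  define d where "d = gcd h g"
  have "d \<noteq> 0" using assms by (simp add: d_def)
  define h' k' g' where "h' = h div d" and "k' = k div d" and "g' = g div d"
  have h: "h = d * h'" and k: "k = d * k'" and g: "g = d * g'"
    using assms(1) by (auto simp: h'_def k'_def g'_def d_def) (metis dvd_mult_div_cancel gcd_dvd1)
  have "coprime h' g'"
    unfolding h'_def g'_def d_def using assms by (intro div_gcd_coprime) auto
  moreover have kg: "coprime k' g'"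
    unfolding k'_def g'_def d_def using assms by (simp add: div_gcd_coprime)
  ultimately obtain s t where st: "s * h' + t * g' = 1"
    by (metis bezout_coefficients_fst_snd coprime_imp_gcd_eq_1)
  \<comment> \<open>\<open>s\<close> inverts \<open>h'\<close> modulo \<open>g'\<close>, so \<open>s * k'\<close> is the wanted multiplier modulo \<open>g'\<close>; adding
    a multiple of \<open>g'\<close> makes it coprime to \<open>f\<close>.\<close>
  have "coprime s g'"
  proof (rule coprimeI)
    fix x assume "x dvd s" "x dvd g'"
    then have "x dvd s * h' + t * g'" by simp
    then show "is_unit x" using st by simp
  qed
  with kg have "coprime (s * k') g'" by simp
  then obtain w where w: "coprime (s * k' + g' * w) f"
    using coprime_add_mult_exists \<open>f \<noteq> 0\<close> by blast
  have "h' * s = 1 - t * g'" using st by (simp add: algebra_simps)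
  then have "h' * s * k' = (1 - t * g') * k'" by simp
  then have eq: "h' * (s * k' + g' * w) - k' = g' * (h' * w - t * k')"
    by (simp add: algebra_simps)
  have "h * (s * k' + g' * w) - k = d * (h' * (s * k' + g' * w) - k')"
    unfolding h k by (simp only: mult.assoc right_diff_distrib)
  also have "\<dots> = g * (h' * w - t * k')"
    unfolding eq g by (simp only: mult.assoc)
  finally have "g dvd h * (s * k' + g' * w) - k" by simp
  with w show ?thesis by blast
qed

section \<open>Monic polynomials and residue classes\<close>

lemma gcd_cong_dvd_diff:
  fixes a b f :: "'a :: ring_gcd"
  assumes "f dvd a - b"
  shows "gcd a f = gcd b f"
proof -
  from assms obtain k where "a - b = f * k" ..
  then have "a = k * f + b" by (simp add: algebra_simps)
  then show ?thesis by (metis gcd.commute gcd_add_mult)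
qed

lemma gcd_gcd_dvd:
  fixes a f g :: "'a :: semiring_gcd"
  assumes "g dvd f"
  shows "gcd (gcd a f) g = gcd a g"
  using assms by (metis gcd.assoc gcd.normalize_right_idem gcd_proj2_iff)

lemma normalize_monic_poly:
  fixes h :: "'a :: field_gcd poly"
  assumes "lead_coeff h = 1"
  shows "normalize h = h"
proof -
  have "unit_factor h = 1" using assms by (simp add: unit_factor_poly_def one_pCons)
  then show ?thesis by (metis div_by_1 div_unit_factor)
qed

lemma lead_coeff_gcd:
  fixes a f :: "'a :: field_gcd poly"
  assumes "f \<noteq> 0"
  shows "lead_coeff (gcd a f) = 1"
proof -
  let ?c = "lead_coeff (gcd a f)"
  have "[:unit_factor ?c:] = 1"
    using assms unit_factor_gcd[of a f] by (simp add: unit_factor_poly_def)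
  then have "unit_factor ?c = 1" by (simp add: one_pCons)
  moreover have "?c \<noteq> 0" using assms by simp
  ultimately show ?thesis by (metis dvd_field_iff is_unit_unit_factor one_neq_zero)
qed

lemma gcd_mem_monic_divisors:
  "f \<noteq> 0 \<Longrightarrow> gcd a f \<in> monic_divisors f"
  by (simp add: monic_divisors_def lead_coeff_gcd)

lemma gcd_monic_divisor:
  assumes "h \<in> monic_divisors f"
  shows "gcd h f = h"
proof -
  have "normalize h = h" and "h dvd f"
    using assms by (simp_all add: monic_divisors_def normalize_monic_poly)
  then show ?thesis using gcd_proj1_iff[of h f] by simp
qed

lemma poly_ideal_eq: "poly_ideal f = {p. f dvd p}"
  by (auto simp: poly_ideal_def cgenideal_def ring_of_type_algebra_def dvd_def mult.commute)

lemma residue_class_eq: "residue_class f u = {p. f dvd p - u}"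
proof -
  have "p \<in> residue_class f u \<longleftrightarrow> f dvd p - u" for p
    by (auto simp: residue_class_def poly_ideal_eq a_r_coset_def' ring_of_type_algebra_def
        intro!: exI[of _ "p - u"])
  then show ?thesis by blast
qed

lemma residue_class_eq_iff: "residue_class f u = residue_class f v \<longleftrightarrow> f dvd u - v"
proof
  assume eq: "residue_class f u = residue_class f v"
  have "u \<in> residue_class f u" by (simp add: residue_class_eq)
  then have "u \<in> residue_class f v" unfolding eq .
  then show "f dvd u - v" by (simp add: residue_class_eq)
next
  assume uv: "f dvd u - v"
  have "f dvd p - u \<longleftrightarrow> f dvd p - v" for p
    using dvd_add_left_iff[OF uv, of "p - u"] by simp
  then show "residue_class f u = residue_class f v" by (simp add: residue_class_eq)
qed

lemma carrier_poly_quot: "carrier (poly_quot f) = range (residue_class f)"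
  by (auto simp: poly_quot_def FactRing_def A_RCOSETS_def' residue_class_def
      ring_of_type_algebra_def)

lemma ideal_poly_ideal: "ideal (poly_ideal f) ring_of_type_algebra"
  unfolding poly_ideal_def
  by (intro cring.cgenideal_ideal cring_from_type_algebra) (simp add: ring_of_type_algebra_def)

lemma cring_poly_quot: "cring (poly_quot f)"
  unfolding poly_quot_def
  by (intro ideal.quotient_is_cring ideal_poly_ideal cring_from_type_algebra)

lemma mult_poly_quot:
  "residue_class f u \<otimes>\<^bsub>poly_quot f\<^esub> residue_class f v = residue_class f (u * v)"
  using ideal.rcoset_mult_add[OF ideal_poly_ideal, of u v f]
  by (simp add: poly_quot_def FactRing_def residue_class_def ring_of_type_algebra_def)

lemma principal_ideal_poly_quot:
  "Idl\<^bsub>poly_quot f\<^esub> {residue_class f g} = residue_class f ` {x. g dvd x}"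
proof -
  have "Idl\<^bsub>poly_quot f\<^esub> {residue_class f g} = PIdl\<^bsub>poly_quot f\<^esub> residue_class f g"
    by (rule cring.cgenideal_eq_genideal[OF cring_poly_quot, symmetric])
      (simp add: carrier_poly_quot)
  also have "\<dots> = {residue_class f (a * g) | a. True}"
    by (auto simp: cgenideal_def carrier_poly_quot mult_poly_quot)
       (metis mult_poly_quot rangeI)
  also have "\<dots> = residue_class f ` {x. g dvd x}"
    by (auto simp: dvd_def mult.commute)
  finally show ?thesis .
qed

section \<open>Graphs on residue classes\<close>

lemma pverts_gcd_graph: "pverts (gcd_graph f D) = range (residue_class f)"
  by (simp add: gcd_graph_def carrier_poly_quot)

lemma parcs_gcd_graph_subset:
  "parcs (gcd_graph f D) \<subseteq> pverts (gcd_graph f D) \<times> pverts (gcd_graph f D)"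
  by (auto simp: gcd_graph_def carrier_poly_quot)

text \<open>
  The arcs are defined by the existence of suitable representatives; since the gcd with \<open>f\<close> only
  depends on residues, any representatives decide adjacency.
\<close>

lemma parcs_gcd_graph_iff:
  "(residue_class f u, residue_class f v) \<in> parcs (gcd_graph f D) \<longleftrightarrow> gcd (u - v) f \<in> D"
proof
  assume "(residue_class f u, residue_class f v) \<in> parcs (gcd_graph f D)"
  then obtain u' v' where *: "f dvd u - u'" "f dvd v - v'" "gcd (u' - v') f \<in> D"
    by (auto simp: gcd_graph_def residue_class_eq_iff)
  have "f dvd (u - v) - (u' - v')"
    using dvd_diff[OF *(1,2)] by (simp add: algebra_simps)
  from gcd_cong_dvd_diff[OF this] *(3) show "gcd (u - v) f \<in> D" by simp
qed (auto simp: gcd_graph_def)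

text \<open>
  For graphs whose arcs are pairs of vertices, an isomorphism is determined by its vertex map; the
  arc map, head and tail that the digraph notion asks for are then forced.
\<close>

lemma isomorphic_graphsI:
  assumes bij: "bij_betw \<phi> (pverts G) (pverts H)"
    and G: "parcs G \<subseteq> pverts G \<times> pverts G"
    and H: "parcs H \<subseteq> pverts H \<times> pverts H"
    and arcs: "\<And>u v. u \<in> pverts G \<Longrightarrow> v \<in> pverts G \<Longrightarrow>
      (u, v) \<in> parcs G \<longleftrightarrow> (\<phi> u, \<phi> v) \<in> parcs H"
  shows "isomorphic_graphs G H"
proof -
  define i where "i = \<lparr> iso_verts = \<phi>, iso_arcs = map_prod \<phi> \<phi>, iso_head = snd, iso_tail = fst \<rparr>"
  have inj: "inj_on \<phi> (pverts G)" and im: "\<phi> ` pverts G = pverts H"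
    using bij by (auto simp: bij_betw_def)
  have "inj_on (map_prod \<phi> \<phi>) (parcs G)"
    using map_prod_inj_on[OF inj inj] G by (rule inj_on_subset)
  moreover have "wf_digraph (with_proj G)"
    using G by unfold_locales auto
  ultimately have "pre_digraph.digraph_isomorphism (with_proj G) i"
    using inj by (auto simp: pre_digraph.digraph_isomorphism_def i_def)
  moreover have "map_prod \<phi> \<phi> ` parcs G = parcs H"
  proof (intro equalityI subrelI)
    fix x y assume "(x, y) \<in> map_prod \<phi> \<phi> ` parcs G"
    then show "(x, y) \<in> parcs H" using arcs G by auto
  next
    fix x y assume xy: "(x, y) \<in> parcs H"
    with H im obtain u v where "u \<in> pverts G" "v \<in> pverts G" "x = \<phi> u" "y = \<phi> v" by blast
    with arcs xy show "(x, y) \<in> map_prod \<phi> \<phi> ` parcs G" by force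
  qed
  then have "with_proj H = app_iso i (with_proj G)"
    using im by (simp add: app_iso_def i_def with_proj_def)
  ultimately show ?thesis unfolding isomorphic_graphs_def digraph_iso_def by blast
qed

section \<open>Homogeneity of the ideal\<close>

lemma dvd_cong_residue_class:
  assumes "g dvd f" and "residue_class f u = residue_class f v"
  shows "g dvd u \<longleftrightarrow> g dvd v"
proof -
  have "g dvd u - v" using assms by (auto simp: residue_class_eq_iff intro: dvd_trans)
  from dvd_add_right_iff[OF this, of v] show ?thesis by simp
qed

lemma homogeneous_ideal_iff:
  assumes "g dvd f"
  shows "homogeneous_set (gcd_graph f D) (residue_class f ` {x. g dvd x}) \<longleftrightarrow>
    (\<forall>v. \<not> g dvd v \<longrightarrow>
      (\<forall>x. g dvd x \<longrightarrow> gcd (v - x) f \<in> D) \<or> (\<forall>x. g dvd x \<longrightarrow> gcd (v - x) f \<notin> D))"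
proof -
  have "range (residue_class f) - residue_class f ` {x. g dvd x} =
      residue_class f ` {v. \<not> g dvd v}"
    by (auto dest: dvd_cong_residue_class[OF assms])
  then show ?thesis
    unfolding homogeneous_set_def pverts_gcd_graph
    by (simp add: parcs_gcd_graph_iff image_subset_iff)
qed

text \<open>
  From right to left, adjacency of \<open>v\<close> to a multiple of \<open>g\<close> transfers to every other multiple,
  because the corresponding divisors of \<open>f\<close> have the same gcd with \<open>g\<close>. From left to right,
  homogeneity is tested at the vertex \<open>k\<close> against \<open>0\<close> and \<open>k - h * c\<close>, where
  \<open>c\<close> is chosen so that the second one is also a multiple of \<open>g\<close>.
\<close>

lemma homogeneous_iff_gcd_closed:
  fixes f g :: "'a :: field_gcd poly" and D :: "'a poly set"
  assumes "f \<noteq> 0" and D: "D \<subseteq> monic_divisors f" and g: "g dvd f"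
  defines "D1 \<equiv> {h \<in> D. \<not> g dvd h}"
  shows "homogeneous_set (gcd_graph f D) (residue_class f ` {x. g dvd x}) \<longleftrightarrow>
    {h \<in> monic_divisors f. gcd h g \<in> (\<lambda>h. gcd h g) ` D1} = D1"
    (is "?hom \<longleftrightarrow> ?closed")
proof -
  have hom_iff: "?hom \<longleftrightarrow> (\<forall>v. \<not> g dvd v \<longrightarrow>
      (\<forall>x. g dvd x \<longrightarrow> gcd (v - x) f \<in> D) \<or> (\<forall>x. g dvd x \<longrightarrow> gcd (v - x) f \<notin> D))"
    by (rule homogeneous_ideal_iff[OF g])
  have "g \<noteq> 0" using g \<open>f \<noteq> 0\<close> by auto
  show ?thesis
  proof
    assume closed: ?closed
    have transfer: "gcd (v - y) f \<in> D"
      if v: "\<not> g dvd v" and x: "g dvd x" and y: "g dvd y" and D: "gcd (v - x) f \<in> D" for v x y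
    proof -
      have gcd_g: "gcd (gcd (v - z) f) g = gcd v g" if "g dvd z" for z
      proof -
        have "gcd (gcd (v - z) f) g = gcd (v - z) g"
          by (rule gcd_gcd_dvd[OF g])
        also have "\<dots> = gcd v g" by (rule gcd_cong_dvd_diff) (use that in simp)
        finally show ?thesis .
      qed
      have "\<not> g dvd gcd (v - x) f"
        using v x by (metis diff_add_cancel dvd_add gcd_dvd1 dvd_trans)
      with D have "gcd (v - x) f \<in> D1" by (simp add: D1_def)
      then have "gcd (gcd (v - y) f) g \<in> (\<lambda>h. gcd h g) ` D1"
        using gcd_g[OF x] gcd_g[OF y] by (metis image_eqI)
      then have "gcd (v - y) f \<in> D1"
        using closed gcd_mem_monic_divisors[OF \<open>f \<noteq> 0\<close>] by blast
      then show ?thesis by (simp add: D1_def)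
    qed
    then show ?hom unfolding hom_iff by blast
  next
    assume ?hom
    have "h \<in> D1" if h: "h \<in> monic_divisors f" and k: "k \<in> D1" and hk: "gcd h g = gcd k g" for h k
    proof -
      have "\<not> g dvd k" using k by (simp add: D1_def)
      have "\<not> g dvd h"
        using hk \<open>\<not> g dvd k\<close> by (metis dvd_refl gcd_dvd1 gcd_greatest dvd_trans)
      obtain c where c: "coprime c f" "g dvd h * c - k"
        using coprime_multiplier_exists[OF hk \<open>g \<noteq> 0\<close> \<open>f \<noteq> 0\<close>] by blast
      have "gcd k f \<in> D"
        using k D gcd_monic_divisor[of k f] by (auto simp: D1_def)
      then have "gcd (k - 0) f \<in> D" by simp
      moreover have "g dvd k - h * c" using c(2) by (metis dvd_minus_iff minus_diff_eq)
      ultimately have "gcd (k - (k - h * c)) f \<in> D"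
        using \<open>?hom\<close> \<open>\<not> g dvd k\<close> unfolding hom_iff by (metis dvd_0_right)
      moreover have "gcd (h * c) f = h"
        using c(1) gcd_monic_divisor[OF h]
        by (simp add: gcd_mult_left_right_cancel coprime_commute)
      ultimately show "h \<in> D1" using \<open>\<not> g dvd h\<close> by (simp add: D1_def)
    qed
    moreover have "D1 \<subseteq> monic_divisors f" using D by (auto simp: D1_def)
    ultimately show ?closed by auto
  qed
qed

section \<open>Division with remainder as the isomorphism\<close>

text \<open>
  Elements congruent modulo \<open>g\<close> leave the same remainder, so their difference is \<open>g\<close> times the
  difference of their quotients. This gives the injectivity of the map and the adjacencies inside
  a class modulo \<open>g\<close>; the hypothesis \<open>closed\<close> gives the adjacencies between different classes.
\<close>

lemma gcd_graph_isomorphic_wreath: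
  fixes f g :: "'a :: field_gcd poly" and D :: "'a poly set"
  assumes "f \<noteq> 0" and D: "D \<subseteq> monic_divisors f" and g: "g \<in> monic_divisors f"
  defines "D1 \<equiv> {h \<in> D. \<not> g dvd h}" and "D2 \<equiv> {h \<in> D. g dvd h}"
  assumes closed: "{h \<in> monic_divisors f. gcd h g \<in> (\<lambda>h. gcd h g) ` D1} = D1"
  shows "isomorphic_graphs (gcd_graph f D)
    (wreath_product (gcd_graph g ((\<lambda>h. gcd h g) ` D1)) (gcd_graph (f div g) ((\<lambda>h. h div g) ` D2)))"
    (is "isomorphic_graphs ?G (wreath_product ?K ?L)")
proof -
  have gf: "g dvd f" and monic: "lead_coeff g = 1" using g by (auto simp: monic_divisors_def)
  have "g \<noteq> 0" using gf \<open>f \<noteq> 0\<close> by auto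
  define m where "m = f div g"
  have f: "f = g * m" using gf by (simp add: m_def)
  \<comment> \<open>The vertex map has to be a function of the coset, so it picks a representative; the next fact
    shows that the choice does not matter.\<close>
  define rep where "rep = inv_into UNIV (residue_class f)"
  define \<phi> where "\<phi> C = (residue_class g (rep C), residue_class m (rep C div g))" for C
  have \<phi>: "\<phi> (residue_class f u) = (residue_class g u, residue_class m (u div g))" for u
  proof -
    have "residue_class f (rep (residue_class f u)) = residue_class f u"
      unfolding rep_def by (rule f_inv_into_f) simp
    then obtain k where "rep (residue_class f u) - u = f * k"
      by (auto simp: residue_class_eq_iff)
    then have k: "rep (residue_class f u) = u + g * (m * k)" by (simp add: f algebra_simps)
    then have "rep (residue_class f u) div g = u div g + m * k"
      using \<open>g \<noteq> 0\<close> by simp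
    with k show ?thesis by (simp add: \<phi>_def residue_class_eq_iff)
  qed
  have diff: "u - v = g * (u div g - v div g)" if "g dvd u - v" for u v
  proof -
    have "u mod g = v mod g" using that by (simp add: mod_eq_dvd_iff)
    then show ?thesis
      by (metis add_diff_cancel_right mult_div_mod_eq right_diff_distrib)
  qed
  have inj: "inj_on \<phi> (range (residue_class f))"
  proof (rule inj_onI, clarsimp simp: \<phi> residue_class_eq_iff)
    fix u v assume "g dvd u - v" "m dvd u div g - v div g"
    with diff show "f dvd u - v" unfolding f by (metis dvd_refl mult_dvd_mono)
  qed
  have surj: "\<phi> ` range (residue_class f) = range (residue_class g) \<times> range (residue_class m)"
  proof (intro equalityI subsetI)
    fix z assume "z \<in> range (residue_class g) \<times> range (residue_class m)"
    then obtain r s where z: "z = (residue_class g r, residue_class m s)" by auto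
    have "residue_class g (r mod g + g * s) = residue_class g r"
      by (simp add: residue_class_eq_iff flip: mod_eq_dvd_iff)
    moreover have "(r mod g + g * s) div g = s"
      using \<open>g \<noteq> 0\<close> by simp
    ultimately have "\<phi> (residue_class f (r mod g + g * s)) = z" by (simp add: \<phi> z)
    then show "z \<in> \<phi> ` range (residue_class f)" by blast
  qed (auto simp: \<phi>)
  have arcs: "gcd (u - v) f \<in> D \<longleftrightarrow>
      gcd (u - v) g \<in> (\<lambda>h. gcd h g) ` D1 \<or>
      g dvd u - v \<and> gcd (u div g - v div g) m \<in> (\<lambda>h. h div g) ` D2" for u v
  proof (cases "g dvd u - v")
    case True
    have "gcd (u - v) g = g"
      using True monic gcd_proj2_iff[of "u - v" g] by (simp add: normalize_monic_poly)
    \<comment> \<open>The first factor of the wreath product has no loops.\<close>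
    moreover have "g \<notin> (\<lambda>h. gcd h g) ` D1"
      by (auto simp: D1_def) (metis gcd_dvd1)
    moreover have "gcd (u - v) f = g * gcd (u div g - v div g) m"
    proof -
      have "gcd (u - v) f = normalize (g * gcd (u div g - v div g) m)"
        by (subst diff[OF True], subst f) (rule gcd_mult_left)
      then show ?thesis by (simp add: normalize_mult normalize_monic_poly monic)
    qed
    moreover have "g * x \<in> D \<longleftrightarrow> x \<in> (\<lambda>h. h div g) ` D2" for x
    proof
      assume "g * x \<in> D"
      then have "g * x \<in> D2" by (simp add: D2_def)
      moreover have "x = (g * x) div g" using \<open>g \<noteq> 0\<close> by simp
      ultimately show "x \<in> (\<lambda>h. h div g) ` D2" by (rule rev_image_eqI)
    qed (auto simp: D2_def)
    ultimately show ?thesis using True by simp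
  next
    case False
    let ?h = "gcd (u - v) f"
    have "?h \<in> D \<longleftrightarrow> ?h \<in> D1" using False by (simp add: D1_def)
    also have "\<dots> \<longleftrightarrow> gcd ?h g \<in> (\<lambda>h. gcd h g) ` D1"
      using gcd_mem_monic_divisors[OF \<open>f \<noteq> 0\<close>, of "u - v"] by (subst (1) closed[symmetric]) simp
    also have "gcd ?h g = gcd (u - v) g" by (rule gcd_gcd_dvd[OF gf])
    finally show ?thesis using False by simp
  qed
  show ?thesis
  proof (rule isomorphic_graphsI)
    show "bij_betw \<phi> (pverts ?G) (pverts (wreath_product ?K ?L))"
      using inj surj by (simp add: bij_betw_def wreath_product_def pverts_gcd_graph m_def)
    show "parcs ?G \<subseteq> pverts ?G \<times> pverts ?G" by (rule parcs_gcd_graph_subset)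
    show "parcs (wreath_product ?K ?L) \<subseteq>
        pverts (wreath_product ?K ?L) \<times> pverts (wreath_product ?K ?L)"
      by (auto simp: wreath_product_def)
    fix U V assume "U \<in> pverts ?G" "V \<in> pverts ?G"
    then obtain u v where "U = residue_class f u" "V = residue_class f v"
      by (auto simp: pverts_gcd_graph)
    then show "(U, V) \<in> parcs ?G \<longleftrightarrow> (\<phi> U, \<phi> V) \<in> parcs (wreath_product ?K ?L)"
      by (simp add: \<phi> wreath_product_def pverts_gcd_graph parcs_gcd_graph_iff arcs
          residue_class_eq_iff rangeI del: image_iff flip: m_def)
  qed
qed

theorem theorem5p5:
  fixes f g :: "'a :: {finite, field_gcd} poly" and D :: "'a poly set"
  assumes "f \<noteq> 0" and "lead_coeff f = 1"
    and "D \<noteq> {}" and "D \<subseteq> monic_divisors f" and "f \<notin> D"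
    and "connected_graph (gcd_graph f D)" and "anti_connected (gcd_graph f D)"
    and "g \<in> monic_divisors f"
  defines "I \<equiv> Idl\<^bsub>poly_quot f\<^esub> {residue_class f g}"
    and "D1 \<equiv> {h \<in> D. \<not> g dvd h}"
    and "D2 \<equiv> {h \<in> D. g dvd h}"
  defines "D1_bar \<equiv> (\<lambda>h. gcd h g) ` D1"
    and "D2_tilde \<equiv> (\<lambda>h. h div g) ` D2"
  shows "(homogeneous_set (gcd_graph f D) I \<longleftrightarrow> {h \<in> monic_divisors f. gcd h g \<in> D1_bar} = D1) \<and>
    (homogeneous_set (gcd_graph f D) I \<longrightarrow>
      isomorphic_graphs (gcd_graph f D)
        (wreath_product (gcd_graph g D1_bar) (gcd_graph (f div g) D2_tilde)))"
proof -
  have gf: "g dvd f" using \<open>g \<in> monic_divisors f\<close> by (simp add: monic_divisors_def)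
  have I: "I = residue_class f ` {x. g dvd x}"
    unfolding I_def by (rule principal_ideal_poly_quot)
  have iff: "homogeneous_set (gcd_graph f D) I \<longleftrightarrow> {h \<in> monic_divisors f. gcd h g \<in> D1_bar} = D1"
    unfolding I D1_bar_def D1_def
    by (rule homogeneous_iff_gcd_closed[OF \<open>f \<noteq> 0\<close> \<open>D \<subseteq> monic_divisors f\<close> gf])
  moreover have "isomorphic_graphs (gcd_graph f D)
      (wreath_product (gcd_graph g D1_bar) (gcd_graph (f div g) D2_tilde))"
    if "{h \<in> monic_divisors f. gcd h g \<in> D1_bar} = D1"
    using gcd_graph_isomorphic_wreath[OF \<open>f \<noteq> 0\<close> \<open>D \<subseteq> monic_divisors f\<close> \<open>g \<in> monic_divisors f\<close>]
      that unfolding D1_bar_def D1_def D2_tilde_def D2_def by blast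
  ultimately show ?thesis by blast
qed

end
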